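(* Let $X$ be a completely regular Hausdorff space. Then $C(X)$ is a von Neumann regular ring if and only if $C(X)$ is an almost regular ring and for every vertex $f$ of $\Gamma(C(X))$ there exists a vertex $g$ of $\Gamma(C(X))$ such that $Z(f)\cap Z(g)=\emptyset$ and $\{f,g\}$ dominates $\Gamma(C(X))$.
   Context: $C(X)$ is the ring of all continuous functions $X\to\mathbb{R}$ with pointwise operations. For $f\in C(X)$, $Z(f)=\{x\in X: f(x)=0\}$. $\Gamma(C(X))$ is the simple graph whose vertex set is the set of non-units of $C(X)$ (equivalently, the $f$ with $Z(f)\neq\emptyset$), two distinct vertices $f,g$ being adjacent iff $Z(f)\cap Z(g)\neq\emptyset$. A set $A$ of vertices dominates the graph if every vertex outside $A$ is adjacent to some vertex of $A$. A commutative ring $R$ with unity is von Neumann regular if for every $a\in R$ there is $x\in R$ with $a=a^2x$; it is almost regular if every non-unit element of $R$ is a zero-divisor.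
   Formalization: The condition is required only for nonzero vertices f: for nonempty X the zero function is a vertex with Z(0)=X, so no vertex g has Z(0)∩Z(g)=∅, and the literal equivalence fails, e.g. for X a single point, where C(X)=ℝ is von Neumann regular. *)

theory Defs
  imports "HOL-Analysis.Analysis" "HOL-Algebra.Ring"
begin

text \<open>
  The ring $C(X)$ on an abstract topology.  Functions are made extensional (\<open>undefined\<close>
  off \<open>topspace X\<close>) so that HOL equality is equality of functions on $X$.
\<close>

definition cont_ring :: "'a topology \<Rightarrow> ('a \<Rightarrow> real) ring"
  where "cont_ring X =
    \<lparr>carrier = {f \<in> extensional (topspace X). continuous_map X euclideanreal f},
     monoid.mult = (\<lambda>f g. \<lambda>x\<in>topspace X. f x * g x),
     one = (\<lambda>x\<in>topspace X. 1),
     zero = (\<lambda>x\<in>topspace X. 0),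
     add = (\<lambda>f g. \<lambda>x\<in>topspace X. f x + g x)\<rparr>"

definition zero_set :: "'a topology \<Rightarrow> ('a \<Rightarrow> real) \<Rightarrow> 'a set"
  where "zero_set X f = {x \<in> topspace X. f x = 0}"

text \<open>A simple graph is given by its vertex set and its set of two-element edges.\<close>

type_synonym 'v sgraph = "'v set \<times> 'v set set"

abbreviation verts :: "'v sgraph \<Rightarrow> 'v set"
  where "verts G \<equiv> fst G"

abbreviation edges :: "'v sgraph \<Rightarrow> 'v set set"
  where "edges G \<equiv> snd G"

definition dominates :: "'v sgraph \<Rightarrow> 'v set \<Rightarrow> bool"
  where "dominates G A \<longleftrightarrow>
    A \<subseteq> verts G \<and> (\<forall>v \<in> verts G - A. \<exists>a\<in>A. {v, a} \<in> edges G)"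

text \<open>
  If $X$ is nonempty, the zero function is a vertex.  Its zero set is all of $X$, so no vertex has
  a zero set disjoint from it; a complementation condition over \<^emph>\<open>all\<close> vertices therefore never
  holds, and the theorem imposes it on the nonzero vertices only.
\<close>

definition zero_set_graph :: "'a topology \<Rightarrow> ('a \<Rightarrow> real) sgraph"
  where "zero_set_graph X =
    (let V = carrier (cont_ring X) - Units (cont_ring X)
     in (V, {{f, g} |f g. f \<in> V \<and> g \<in> V \<and> f \<noteq> g \<and> zero_set X f \<inter> zero_set X g \<noteq> {}}))"

definition von_neumann_regular :: "('a, 'b) ring_scheme \<Rightarrow> bool"
  where "von_neumann_regular R \<longleftrightarrow>
    cring R \<and> (\<forall>a \<in> carrier R. \<exists>x \<in> carrier R. a = a [^]\<^bsub>R\<^esub> (2::nat) \<otimes>\<^bsub>R\<^esub> x)"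

text \<open>In a nonzero ring, \<open>\<zero>\<close> counts as a zero-divisor; otherwise no field would be almost regular.\<close>

definition zero_divisor :: "('a, 'b) ring_scheme \<Rightarrow> 'a \<Rightarrow> bool"
  where "zero_divisor R a \<longleftrightarrow>
    a \<in> carrier R \<and> (\<exists>b \<in> carrier R. b \<noteq> \<zero>\<^bsub>R\<^esub> \<and> a \<otimes>\<^bsub>R\<^esub> b = \<zero>\<^bsub>R\<^esub>)"

definition almost_regular :: "('a, 'b) ring_scheme \<Rightarrow> bool"
  where "almost_regular R \<longleftrightarrow>
    cring R \<and> (\<forall>a \<in> carrier R - Units R. zero_divisor R a)"

lemma cring_cont_ring: "cring (cont_ring X)"
proof (rule cringI)
  show "abelian_group (cont_ring X)"
  proof (rule abelian_groupI)
    fix f assume f: "f \<in> carrier (cont_ring X)"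
    show "\<exists>g\<in>carrier (cont_ring X). g \<oplus>\<^bsub>cont_ring X\<^esub> f = \<zero>\<^bsub>cont_ring X\<^esub>"
      using f
      by (intro bexI[where x = "\<lambda>x\<in>topspace X. - f x"])
        (auto simp: cont_ring_def fun_eq_iff intro: continuous_map_eq[OF continuous_map_minus])
  qed (auto simp: cont_ring_def fun_eq_iff restrict_def extensional_def
         intro: continuous_map_eq[OF continuous_map_add] continuous_map_eq[of _ _ "\<lambda>_. 0"])
  show "comm_monoid (cont_ring X)"
    by (rule comm_monoidI)
      (auto simp: cont_ring_def fun_eq_iff restrict_def extensional_def
         intro: continuous_map_eq[OF continuous_map_real_mult] continuous_map_eq[of _ _ "\<lambda>_. 1"])
qed (auto simp: cont_ring_def fun_eq_iff algebra_simps)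

text \<open>Non-units are the functions with nonempty zero set.\<close>

lemma verts_zero_set_graph:
  "verts (zero_set_graph X) = {f \<in> carrier (cont_ring X). zero_set X f \<noteq> {}}"
proof -
  have "f \<in> Units (cont_ring X) \<longleftrightarrow> zero_set X f = {}" if f: "f \<in> carrier (cont_ring X)" for f
  proof
    assume "f \<in> Units (cont_ring X)"
    then obtain g where "g \<otimes>\<^bsub>cont_ring X\<^esub> f = \<one>\<^bsub>cont_ring X\<^esub>"
      by (auto simp: Units_def)
    then have "g x * f x = 1" if "x \<in> topspace X" for x
      using that by (auto simp: cont_ring_def fun_eq_iff restrict_def split: if_splits)
    then show "zero_set X f = {}"
      by (force simp: zero_set_def)
  next
    assume z: "zero_set X f = {}"
    define g where "g = (\<lambda>x\<in>topspace X. inverse (f x))"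
    have "continuous_map X euclideanreal (\<lambda>x. inverse (f x))"
      using f z by (intro continuous_map_real_inverse) (auto simp: cont_ring_def zero_set_def)
    then have "g \<in> carrier (cont_ring X)"
      by (auto simp: g_def cont_ring_def intro: continuous_map_eq)
    then show "f \<in> Units (cont_ring X)"
      using f z unfolding Units_def
      by (auto simp: g_def cont_ring_def zero_set_def fun_eq_iff intro!: bexI[where x = g])
  qed
  then show ?thesis
    by (auto simp: zero_set_graph_def Let_def)
qed

end

theory Submission
  imports Defs
begin

text \<open>
  Domination by \<open>{f, g}\<close> forces \<open>Z(f) \<union> Z(g) = X\<close>: complete regularity would otherwise supply a vertex
  that vanishes at a point outside both zero sets and equals \<open>1\<close> on them.  When the two zero sets
  partition \<open>X\<close>, the denominator of \<open>f / (f\<^sup>2 + g\<^sup>2)\<close> never vanishes, and this is a quasi-inverse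
  of \<open>f\<close>.  Conversely, if \<open>f = f\<^sup>2 x\<close>, then \<open>1 - f x\<close> is idempotent, annihilates \<open>f\<close> and has
  the complement of \<open>Z(f)\<close> as its zero set.
\<close>

lemma carrier_cont_ring_iff:
  "f \<in> carrier (cont_ring X) \<longleftrightarrow>
    f \<in> extensional (topspace X) \<and> continuous_map X euclideanreal f"
  by (simp add: cont_ring_def)

lemma restrict_in_carrier_cont_ring:
  assumes "continuous_map X euclideanreal f"
  shows "restrict f (topspace X) \<in> carrier (cont_ring X)"
  using assms by (auto simp: carrier_cont_ring_iff intro: continuous_map_eq)

lemma cont_ring_eqI:
  assumes "f \<in> carrier (cont_ring X)" "g \<in> carrier (cont_ring X)"
    and "\<And>p. p \<in> topspace X \<Longrightarrow> f p = g p"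
  shows "f = g"
  using assms by (auto simp: carrier_cont_ring_iff intro: extensionalityI)

lemma mult_cont_ring_apply:
  "p \<in> topspace X \<Longrightarrow> (f \<otimes>\<^bsub>cont_ring X\<^esub> g) p = f p * g p"
  by (simp add: cont_ring_def)

lemma zero_cont_ring_apply: "p \<in> topspace X \<Longrightarrow> \<zero>\<^bsub>cont_ring X\<^esub> p = 0"
  by (simp add: cont_ring_def)

lemma cont_ring_eq_zero_iff:
  assumes "f \<in> carrier (cont_ring X)"
  shows "f = \<zero>\<^bsub>cont_ring X\<^esub> \<longleftrightarrow> zero_set X f = topspace X"
proof -
  interpret cring "cont_ring X" by (rule cring_cont_ring)
  show ?thesis
    using assms cont_ring_eqI[OF assms zero_closed]
    by (auto simp: zero_set_def zero_cont_ring_apply)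
qed

text \<open>A doubleton determines its two members only up to order; since the adjacency condition
  is symmetric, it can be read off in the given order.\<close>

lemma edge_zero_set_graph_iff:
  "{f, g} \<in> edges (zero_set_graph X) \<longleftrightarrow>
    f \<in> verts (zero_set_graph X) \<and> g \<in> verts (zero_set_graph X) \<and> f \<noteq> g \<and>
    zero_set X f \<inter> zero_set X g \<noteq> {}"
  unfolding zero_set_graph_def Let_def fst_conv snd_conv
  by (fastforce simp: doubleton_eq_iff)

text \<open>Both sides of the ring equation lie in the carrier, hence are extensional, so comparing
  values on \<open>topspace X\<close> is enough. This replaces ring arithmetic by real arithmetic
  from here on.\<close>

lemma von_neumann_regular_cont_ring_iff:
  "von_neumann_regular (cont_ring X) \<longleftrightarrow>
    (\<forall>f \<in> carrier (cont_ring X). \<exists>x \<in> carrier (cont_ring X).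
      \<forall>p \<in> topspace X. f p = (f p)\<^sup>2 * x p)"
proof -
  interpret cring "cont_ring X" by (rule cring_cont_ring)
  have "f = f [^]\<^bsub>cont_ring X\<^esub> (2::nat) \<otimes>\<^bsub>cont_ring X\<^esub> x \<longleftrightarrow>
      (\<forall>p \<in> topspace X. f p = (f p)\<^sup>2 * x p)" (is "f = ?r \<longleftrightarrow> _")
    if f: "f \<in> carrier (cont_ring X)" and x: "x \<in> carrier (cont_ring X)" for f x
  proof -
    have r: "?r p = (f p)\<^sup>2 * x p" if "p \<in> topspace X" for p
      using f that by (simp add: numeral_2_eq_2 mult_cont_ring_apply)
    have "f = ?r \<longleftrightarrow> (\<forall>p \<in> topspace X. f p = ?r p)"
      using f x by (metis cont_ring_eqI m_closed nat_pow_closed)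
    then show ?thesis by (simp add: r)
  qed
  then show ?thesis
    by (simp add: von_neumann_regular_def is_cring)
qed

lemma von_neumann_regular_cont_ring_complement:
  assumes "von_neumann_regular (cont_ring X)" and "f \<in> carrier (cont_ring X)"
  obtains g where "g \<in> carrier (cont_ring X)" "zero_set X g = topspace X - zero_set X f"
proof -
  obtain x where x: "x \<in> carrier (cont_ring X)"
    and fx: "\<And>p. p \<in> topspace X \<Longrightarrow> f p = (f p)\<^sup>2 * x p"
    using assms by (auto simp: von_neumann_regular_cont_ring_iff)
  define g where "g = (\<lambda>p\<in>topspace X. 1 - f p * x p)"
  \<comment> \<open>Cancelling \<open>f p\<close> where it is nonzero gives
    \<open>f p * x p = 1\<close>; where \<open>f p = 0\<close>, the value of \<open>g\<close> is 1.
    So \<open>g\<close> is the indicator function of the zero set of \<open>f\<close>.\<close>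
  have "g p = 0 \<longleftrightarrow> f p \<noteq> 0" if "p \<in> topspace X" for p
    using fx[OF that] that by (auto simp: g_def power2_eq_square)
  then have "zero_set X g = topspace X - zero_set X f"
    by (auto simp: zero_set_def)
  moreover have "g \<in> carrier (cont_ring X)"
    using assms(2) x unfolding g_def carrier_cont_ring_iff[of f] carrier_cont_ring_iff[of x]
    by (intro restrict_in_carrier_cont_ring continuous_intros) auto
  ultimately show thesis
    by (rule that[rotated])
qed

text \<open>The function with the complementary zero set annihilates \<open>f\<close>, and it is
  nonzero because a non-unit \<open>f\<close> vanishes somewhere.\<close>

lemma von_neumann_regular_imp_almost_regular_cont_ring:
  assumes "von_neumann_regular (cont_ring X)"
  shows "almost_regular (cont_ring X)"
  unfolding almost_regular_def
proof (intro conjI ballI)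
  interpret cring "cont_ring X" by (rule cring_cont_ring)
  show "cring (cont_ring X)" ..
  fix f assume "f \<in> carrier (cont_ring X) - Units (cont_ring X)"
  then have "f \<in> verts (zero_set_graph X)"
    by (simp add: zero_set_graph_def Let_def)
  then have f: "f \<in> carrier (cont_ring X)" "zero_set X f \<noteq> {}"
    by (auto simp: verts_zero_set_graph)
  obtain g where g: "g \<in> carrier (cont_ring X)"
    and zg: "zero_set X g = topspace X - zero_set X f"
    using von_neumann_regular_cont_ring_complement[OF assms f(1)] .
  have "zero_set X f \<subseteq> topspace X"
    by (auto simp: zero_set_def)
  then have "g \<noteq> \<zero>\<^bsub>cont_ring X\<^esub>"
    using f(2) g zg by (auto simp: cont_ring_eq_zero_iff)
  moreover have "f \<otimes>\<^bsub>cont_ring X\<^esub> g = \<zero>\<^bsub>cont_ring X\<^esub>"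
  proof (rule cont_ring_eqI)
    fix p assume "p \<in> topspace X"
    then show "(f \<otimes>\<^bsub>cont_ring X\<^esub> g) p = \<zero>\<^bsub>cont_ring X\<^esub> p"
      using zg by (auto simp: mult_cont_ring_apply zero_cont_ring_apply zero_set_def)
  qed (use f(1) g in auto)
  ultimately show "zero_divisor (cont_ring X) f"
    using f(1) g by (auto simp: zero_divisor_def)
qed

text \<open>The zero set of a vertex is nonempty, so it must meet one of two sets that cover the
  space.\<close>

lemma zero_sets_cover_imp_dominates:
  assumes "f \<in> verts (zero_set_graph X)" "g \<in> verts (zero_set_graph X)"
    and "zero_set X f \<union> zero_set X g = topspace X"
  shows "dominates (zero_set_graph X) {f, g}"
  unfolding dominates_def
proof (intro conjI ballI)
  show "{f, g} \<subseteq> verts (zero_set_graph X)"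
    using assms by simp
  fix v assume v: "v \<in> verts (zero_set_graph X) - {f, g}"
  then have "zero_set X v \<noteq> {}" "zero_set X v \<subseteq> topspace X"
    by (auto simp: verts_zero_set_graph zero_set_def)
  then have "zero_set X v \<inter> zero_set X f \<noteq> {} \<or> zero_set X v \<inter> zero_set X g \<noteq> {}"
    using assms(3) by blast
  then show "\<exists>a\<in>{f, g}. {v, a} \<in> edges (zero_set_graph X)"
    using v assms(1,2) by (auto simp: edge_zero_set_graph_iff)
qed

lemma closedin_zero_set:
  assumes "f \<in> carrier (cont_ring X)"
  shows "closedin X (zero_set X f)"
  using assms closedin_continuous_map_preimage[of X euclideanreal f "{0}"]
  by (simp add: carrier_cont_ring_iff zero_set_def)

lemma dominates_imp_zero_sets_cover:
  assumes "completely_regular_space X" and dom: "dominates (zero_set_graph X) {f, g}"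
  shows "zero_set X f \<union> zero_set X g = topspace X"
proof (rule ccontr)
  let ?S = "zero_set X f \<union> zero_set X g"
  assume "?S \<noteq> topspace X"
  then obtain p where p: "p \<in> topspace X - ?S"
    by (auto simp: zero_set_def)
  have vert: "f \<in> verts (zero_set_graph X)" "g \<in> verts (zero_set_graph X)"
    using dom by (auto simp: dominates_def)
  then have "closedin X ?S"
    by (auto simp: verts_zero_set_graph closedin_zero_set)
  \<comment> \<open>The orientation matters: the value 0 at \<open>p\<close> makes the restriction
    of \<open>h\<close> a non-unit, and the value 1 on \<open>?S\<close> keeps its zero set away
    from both \<open>f\<close> and \<open>g\<close>.\<close>
  then obtain h where h: "continuous_map X (top_of_set {0..1}) h" "h p = (0::real)" "h ` ?S \<subseteq> {1}"
    using assms(1) p unfolding completely_regular_space_def by metis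
  define v where "v = restrict h (topspace X)"
  have "v \<in> carrier (cont_ring X)"
    using h(1) unfolding v_def
    by (intro restrict_in_carrier_cont_ring) (simp add: continuous_map_in_subtopology)
  moreover have "p \<in> zero_set X v"
    using p h(2) by (simp add: v_def zero_set_def)
  ultimately have vv: "v \<in> verts (zero_set_graph X)"
    by (auto simp: verts_zero_set_graph)
  have disj: "zero_set X v \<inter> ?S = {}"
    using h(3) by (auto simp: v_def zero_set_def)
  \<comment> \<open>Domination says something only about vertices outside \<open>{f, g}\<close>. If
    \<open>v\<close> were \<open>f\<close> or \<open>g\<close>, its nonempty zero set would lie in
    \<open>?S\<close>.\<close>
  then have "v \<notin> {f, g}"
    using vert by (auto simp: verts_zero_set_graph)
  then have "\<exists>a\<in>{f, g}. {v, a} \<in> edges (zero_set_graph X)"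
    using dom vv by (auto simp: dominates_def)
  then show False
    using disj by (auto simp: edge_zero_set_graph_iff)
qed

lemma complementary_zero_sets_quasi_inverse:
  assumes f: "f \<in> carrier (cont_ring X)" and g: "g \<in> carrier (cont_ring X)"
    and disj: "zero_set X f \<inter> zero_set X g = {}"
    and cover: "zero_set X f \<union> zero_set X g = topspace X"
  shows "\<exists>x \<in> carrier (cont_ring X). \<forall>p \<in> topspace X. f p = (f p)\<^sup>2 * x p"
proof
  \<comment> \<open>Under the two hypotheses \<open>x\<close> is \<open>1 / f\<close> off the zero
    set of \<open>f\<close> and 0 on it. Disjointness keeps the denominator nonzero, which gives
    continuity; the cover makes \<open>g\<close> vanish wherever \<open>f\<close> does not.\<close>
  define x where "x = (\<lambda>p\<in>topspace X. f p / ((f p)\<^sup>2 + (g p)\<^sup>2))"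
  have "(f p)\<^sup>2 + (g p)\<^sup>2 \<noteq> 0" if "p \<in> topspace X" for p
    using that disj by (auto simp: zero_set_def sum_power2_eq_zero_iff)
  then show "x \<in> carrier (cont_ring X)"
    using f g unfolding x_def carrier_cont_ring_iff[of f] carrier_cont_ring_iff[of g]
    by (intro restrict_in_carrier_cont_ring continuous_map_real_divide continuous_intros) auto
  show "\<forall>p \<in> topspace X. f p = (f p)\<^sup>2 * x p"
  proof
    fix p assume p: "p \<in> topspace X"
    then have "f p = 0 \<or> g p = 0"
      using cover by (auto simp: zero_set_def)
    then show "f p = (f p)\<^sup>2 * x p"
      using p by (auto simp: x_def power2_eq_square)
  qed
qed

theorem theorem4p3:
  fixes X :: "'a topology"
  assumes "completely_regular_space X" and "Hausdorff_space X"
  shows "von_neumann_regular (cont_ring X) \<longleftrightarrow>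
    almost_regular (cont_ring X) \<and>
    (\<forall>f \<in> verts (zero_set_graph X). f \<noteq> \<zero>\<^bsub>cont_ring X\<^esub> \<longrightarrow>
      (\<exists>g \<in> verts (zero_set_graph X).
        zero_set X f \<inter> zero_set X g = {} \<and> dominates (zero_set_graph X) {f, g}))"
    (is "?vnr \<longleftrightarrow> ?ar \<and> ?compl")
proof
  assume vnr: ?vnr
  have ?compl
  proof (intro ballI impI)
    fix f assume f: "f \<in> verts (zero_set_graph X)" and nz: "f \<noteq> \<zero>\<^bsub>cont_ring X\<^esub>"
    then have fc: "f \<in> carrier (cont_ring X)"
      by (simp add: verts_zero_set_graph)
    obtain g where g: "g \<in> carrier (cont_ring X)"
      and zg: "zero_set X g = topspace X - zero_set X f"
      using von_neumann_regular_cont_ring_complement[OF vnr fc] .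
    have sub: "zero_set X f \<subseteq> topspace X"
      by (auto simp: zero_set_def)
    \<comment> \<open>A nonzero \<open>f\<close> has a zero set smaller than
      \<open>topspace X\<close>, so the complement is nonempty and \<open>g\<close> is a
      non-unit.\<close>
    have gv: "g \<in> verts (zero_set_graph X)"
      using g nz fc zg sub by (auto simp: verts_zero_set_graph cont_ring_eq_zero_iff)
    have "dominates (zero_set_graph X) {f, g}"
      using f gv by (rule zero_sets_cover_imp_dominates) (use zg sub in auto)
    then show "\<exists>g \<in> verts (zero_set_graph X).
        zero_set X f \<inter> zero_set X g = {} \<and> dominates (zero_set_graph X) {f, g}"
      using gv zg by blast
  qed
  then show "?ar \<and> ?compl"
    using von_neumann_regular_imp_almost_regular_cont_ring[OF vnr] by simp
next
  assume "?ar \<and> ?compl"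
  then have compl: ?compl ..
  interpret cring "cont_ring X" by (rule cring_cont_ring)
  \<comment> \<open>Here \<open>g\<close> ranges over the whole carrier, since regularity concerns
    every \<open>f\<close>, whereas the graph condition reaches only nonzero non-units. For zero and
    for units the constants 1 and 0 serve as complements.\<close>
  have "\<exists>g \<in> carrier (cont_ring X).
      zero_set X f \<inter> zero_set X g = {} \<and> zero_set X f \<union> zero_set X g = topspace X"
    if f: "f \<in> carrier (cont_ring X)" for f
  proof -
    consider "f = \<zero>\<^bsub>cont_ring X\<^esub>" | "zero_set X f = {}"
      | "f \<noteq> \<zero>\<^bsub>cont_ring X\<^esub>" "f \<in> verts (zero_set_graph X)"
      using f by (auto simp: verts_zero_set_graph)
    then show ?thesis
    proof cases
      case 1
      have "zero_set X \<one>\<^bsub>cont_ring X\<^esub> = {}"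
        by (auto simp: zero_set_def cont_ring_def)
      then show ?thesis
        using 1 f by (intro bexI[of _ "\<one>\<^bsub>cont_ring X\<^esub>"]) (auto simp: cont_ring_eq_zero_iff)
    next
      case 2
      have "zero_set X \<zero>\<^bsub>cont_ring X\<^esub> = topspace X"
        by (simp flip: cont_ring_eq_zero_iff)
      then show ?thesis
        using 2 by (intro bexI[of _ "\<zero>\<^bsub>cont_ring X\<^esub>"]) auto
    next
      case 3
      then obtain g where "g \<in> verts (zero_set_graph X)" "zero_set X f \<inter> zero_set X g = {}"
        and "dominates (zero_set_graph X) {f, g}"
        using compl by blast
      then show ?thesis
        using dominates_imp_zero_sets_cover[OF assms(1)]
        by (intro bexI[of _ g]) (simp_all add: verts_zero_set_graph)
    qed
  qed
  then show ?vnr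
    unfolding von_neumann_regular_cont_ring_iff
    by (meson complementary_zero_sets_quasi_inverse)
qed

end
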